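(* Let $C$ be a nonempty closed convex subset of a real Hilbert space $H$ and $T$ a $\kappa$-strict pseudo-contraction of $C$ into itself for some $0\le\kappa<1$ with $F(T)\ne\emptyset$. Let $\{\alpha_n\}_{n\ge0}$ be a real sequence with $0<\alpha\le\alpha_n\le1$ for all $n$ (for some constant $\alpha$). Let $x_0\in C$ be arbitrary and let $\{x_n\}$ be given, for $n\ge0$, by $$y_n=(1-\alpha_n)x_n+\alpha_nTx_n,$$ $$C_n=\{z\in C:\|y_n-z\|^2\le\|x_n-z\|^2+\alpha_n(\kappa-(1-\alpha_n))\|x_n-Tx_n\|^2\},$$ $$Q_n=\{z\in C:\langle z-x_n,x_n-x_0\rangle\ge0\},$$ $$x_{n+1}=P_{C_n^*\cap Q_n}x_0,$$ where $C_n^*$ is a closed convex set with $F(T)\subset C_n^*\subset C_n$. Then $\{x_n\}$ converges strongly to $P_{F(T)}x_0$.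
   Context: $F(T)=\{x\in C:Tx=x\}$. $T$ is a $\kappa$-strict pseudo-contraction if $\|Tx-Ty\|^2\le\|x-y\|^2+\kappa\|(I-T)x-(I-T)y\|^2$ for all $x,y\in C$ ($I$ the identity). For a nonempty closed convex set $D\subset H$, $P_D$ is the metric projection (nearest-point map) onto $D$. *)

theory Defs
  imports "HOL-Analysis.Analysis"
begin

definition strict_pseudo_contraction_on ::
  "real \<Rightarrow> 'a::real_inner set \<Rightarrow> ('a \<Rightarrow> 'a) \<Rightarrow> bool"
  where "strict_pseudo_contraction_on \<kappa> C T \<longleftrightarrow>
    (\<forall>x\<in>C. \<forall>y\<in>C.
      (norm (T x - T y))\<^sup>2 \<le> (norm (x - y))\<^sup>2 + \<kappa> * (norm ((x - T x) - (y - T y)))\<^sup>2)"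

definition fixed_points_on :: "'a set \<Rightarrow> ('a \<Rightarrow> 'a) \<Rightarrow> 'a set"
  where "fixed_points_on C T = {x \<in> C. T x = x}"

(* The library's closest_point is restricted to heine_borel spaces, hence to finite dimension.
   The value below is unspecified unless D has a unique nearest point to x; in a Hilbert space
   there is one whenever D is nonempty, closed and convex. *)
definition metric_proj :: "'a::real_inner set \<Rightarrow> 'a \<Rightarrow> 'a"
  where "metric_proj D x = (THE p. p \<in> D \<and> (\<forall>z\<in>D. norm (x - p) \<le> norm (x - z)))"

end

theory Submission
  imports Defs
begin

text \<open>
  Write \<open>A = I - T\<close> for the displacement and \<open>a = x 0\<close> for the anchor. The set \<open>Q n\<close> is a half-space
  cut of \<open>C\<close> whose point nearest to \<open>a\<close> is \<open>x n\<close> itself. As \<open>x (Suc n)\<close> lies in \<open>Q n\<close>, the distances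
  \<open>norm (x n - a)\<close> never decrease, and Pythagoras' inequality bounds the squared step length by the
  increment of the squared distance. The variational inequality for the projection that defines
  \<open>x (Suc n)\<close> keeps the fixed points inside every \<open>Q n\<close>, so these distances never exceed the distance
  from \<open>a\<close> to a fixed point; hence the steps tend to \<open>0\<close>. Membership of \<open>x (Suc n)\<close> in \<open>Cn n\<close>
  forces \<open>norm (A (x n))\<close> to be at most a constant times the step length
  (\<open>displacement_le_of_hybrid_cut\<close>), so \<open>A (x n)\<close> tends to \<open>0\<close>.

  It remains to deduce strong convergence from these two facts (\<open>tendsto_nearest_fixed_point\<close>). The
  usual argument extracts weak limits and applies demiclosedness of \<open>A\<close> at \<open>0\<close>. The proof here
  compares \<open>x n\<close> with a path of approximate fixed points instead. The strict pseudo-contraction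
  inequality is an inner product inequality for \<open>A\<close> (\<open>displacement_inner_ge\<close>), which
  makes \<open>A\<close> monotone and Lipschitz. The equation \<open>A z = l *\<^sub>R (a - z)\<close> therefore has a solution \<open>z\<close>
  in \<open>C\<close> for each \<open>l > 0\<close>, and as \<open>l\<close> decreases to \<open>0\<close> monotonicity alone forces these solutions to
  converge to a fixed point \<open>q\<close>, the one nearest to \<open>a\<close> (\<open>path_to_nearest_fixed_point\<close>). Applied to
  \<open>x n\<close> and a path point \<open>z\<close>, monotonicity gives, with \<open>R = norm (q - a)\<close>,
  \<open>(norm (x n - z))\<^sup>2 \<le> (R\<^sup>2 - (norm (z - a))\<^sup>2) + 4 * R / l * norm (A (x n))\<close>.
  The first summand is small when \<open>z\<close> is near \<open>q\<close>; with \<open>z\<close> and \<open>l\<close> held fixed, the second tends to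
  \<open>0\<close> in \<open>n\<close>.
\<close>

section \<open>Nearest points in Hilbert space\<close>

text \<open>
  Completeness enters through this criterion in both limit constructions: minimising sequences, and
  the path towards the nearest fixed point. There \<open>g n\<close> measures how far a squared distance at
  stage \<open>n\<close> is from its limit.
\<close>
lemma Cauchy_if_norm_sq_diff_le:
  fixes u :: "nat \<Rightarrow> 'a::real_inner"
  assumes le: "\<And>m n. m \<le> n \<Longrightarrow> (norm (u m - u n))\<^sup>2 \<le> g m + g n" and g: "g \<longlonglongrightarrow> 0"
  shows "Cauchy u"
proof (rule metric_CauchyI)
  fix e :: real assume e: "0 < e"
  then have "eventually (\<lambda>n. g n < e\<^sup>2 / 2) sequentially"
    using order_tendstoD(2)[OF g, of "e\<^sup>2 / 2"] by simp
  then obtain N where N: "\<And>n. n \<ge> N \<Longrightarrow> g n < e\<^sup>2 / 2"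
    by (auto simp: eventually_sequentially)
  have "dist (u m) (u n) < e" if "m \<ge> N" "n \<ge> N" for m n
  proof -
    have "(norm (u m - u n))\<^sup>2 \<le> g m + g n"
      using le[of m n] le[of n m] by (cases "m \<le> n") (auto simp: norm_minus_commute)
    also have "\<dots> < e\<^sup>2" using N[OF that(1)] N[OF that(2)] by simp
    finally show ?thesis using e by (simp add: dist_norm power_less_imp_less_base)
  qed
  then show "\<exists>N. \<forall>m\<ge>N. \<forall>n\<ge>N. dist (u m) (u n) < e" by blast
qed

text \<open>
  By the parallelogram law, two almost nearest points are close to each other, since their midpoint
  stays in \<open>D\<close>; so a minimising sequence is Cauchy.
\<close>
lemma nearest_point_exists:
  fixes D :: "'a::{real_inner, complete_space} set"
  assumes "closed D" "convex D" "D \<noteq> {}"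
  obtains p where "p \<in> D" "\<And>z. z \<in> D \<Longrightarrow> norm (x - p) \<le> norm (x - z)"
proof -
  define d where "d = infdist x D"
  have d_le: "d \<le> norm (x - z)" if "z \<in> D" for z
    using infdist_le[OF that, of x] by (simp add: d_def dist_norm)
  have d_nonneg: "0 \<le> d" by (simp add: d_def infdist_nonneg)
  have "\<exists>z\<in>D. norm (x - z) < d + inverse (real (Suc n))" for n
  proof -
    have "Inf (dist x ` D) < d + inverse (real (Suc n))"
      using \<open>D \<noteq> {}\<close> by (simp add: d_def infdist_def)
    then show ?thesis using cInf_lessD[of "dist x ` D"] \<open>D \<noteq> {}\<close> by (auto simp: dist_norm)
  qed
  then obtain u where u: "\<And>n. u n \<in> D" "\<And>n. norm (x - u n) < d + inverse (real (Suc n))"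
    by metis
  have lim: "(\<lambda>n. norm (x - u n)) \<longlonglongrightarrow> d"
  proof (rule tendsto_sandwich)
    show "(\<lambda>n. d) \<longlonglongrightarrow> d" by simp
    show "(\<lambda>n. d + inverse (real (Suc n))) \<longlonglongrightarrow> d" by (rule LIMSEQ_inverse_real_of_nat_add)
  qed (use d_le u in \<open>auto intro!: always_eventually intro: less_imp_le simp del: of_nat_Suc\<close>)
  have "Cauchy u"
  proof (rule Cauchy_if_norm_sq_diff_le)
    show "(\<lambda>n. 2 * ((norm (x - u n))\<^sup>2 - d\<^sup>2)) \<longlonglongrightarrow> 0"
      using tendsto_mult_right_zero[OF LIM_zero[OF tendsto_power[OF lim, of 2]], of 2] by simp
    fix m n
    have "midpoint (u m) (u n) \<in> D" 
      using assms(2) u(1) unfolding midpoint_def scaleR_add_right by (intro convexD) auto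
    then have "d\<^sup>2 \<le> (norm (x - midpoint (u m) (u n)))\<^sup>2"
      using d_le d_nonneg by (simp add: power_mono)
    moreover have "(norm (u m - u n))\<^sup>2 + 4 * (norm (x - midpoint (u m) (u n)))\<^sup>2
        = 2 * (norm (x - u m))\<^sup>2 + 2 * (norm (x - u n))\<^sup>2"
      unfolding midpoint_def power2_norm_eq_inner
      by (simp add: inner_simps inner_commute field_simps)
    ultimately show "(norm (u m - u n))\<^sup>2
        \<le> 2 * ((norm (x - u m))\<^sup>2 - d\<^sup>2) + 2 * ((norm (x - u n))\<^sup>2 - d\<^sup>2)"
      by simp
  qed
  then obtain p where p: "u \<longlonglongrightarrow> p" using Cauchy_convergent convergent_def by blast
  have "p \<in> D" using closed_sequentially[OF assms(1) _ p] u(1) by blast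
  moreover have "(\<lambda>n. norm (x - u n)) \<longlonglongrightarrow> norm (x - p)" by (intro tendsto_intros p)
  with lim have "norm (x - p) = d" using LIMSEQ_unique by blast
  ultimately show thesis using that d_le by auto
qed

lemma norm_sq_three_points:
  fixes p x z :: "'a::real_inner"
  shows "(norm (z - x))\<^sup>2 = (norm (p - x))\<^sup>2 + (norm (z - p))\<^sup>2 + 2 * ((z - p) \<bullet> (p - x))"
proof -
  have "z - x = (p - x) + (z - p)" by simp
  then show ?thesis by (simp only: power2_norm_eq_inner inner_simps) (simp add: inner_commute)
qed

text \<open>
  The variational inequality is what the limit arguments produce. By Pythagoras it makes every
  other point of \<open>D\<close> strictly farther from \<open>x\<close>.
\<close>
lemma metric_proj_eqI:
  fixes D :: "'a::real_inner set"
  assumes p: "p \<in> D" and le: "\<And>z. z \<in> D \<Longrightarrow> 0 \<le> (z - p) \<bullet> (p - x)"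
  shows "metric_proj D x = p"
  unfolding metric_proj_def
proof (rule the_equality)
  have gap: "(norm (x - p))\<^sup>2 + (norm (z - p))\<^sup>2 \<le> (norm (x - z))\<^sup>2" if "z \<in> D" for z
    using le[OF that] norm_sq_three_points[of z x p] by (simp add: norm_minus_commute)
  have "norm (x - p) \<le> norm (x - z)" if "z \<in> D" for z
    using gap[OF that] by (smt (verit) norm_ge_zero power2_le_imp_le zero_le_power2)
  then show "p \<in> D \<and> (\<forall>z\<in>D. norm (x - p) \<le> norm (x - z))" using p by blast
  fix r assume r: "r \<in> D \<and> (\<forall>z\<in>D. norm (x - r) \<le> norm (x - z))"
  then have "(norm (x - r))\<^sup>2 \<le> (norm (x - p))\<^sup>2" using p by (simp add: power_mono)
  moreover have "(norm (x - p))\<^sup>2 + (norm (r - p))\<^sup>2 \<le> (norm (x - r))\<^sup>2" using gap r by blast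
  ultimately have "(norm (r - p))\<^sup>2 \<le> 0" by linarith
  then show "r = p" by simp
qed

lemma
  fixes D :: "'a::{real_inner, complete_space} set"
  assumes "closed D" "convex D" "D \<noteq> {}"
  shows metric_proj_mem: "metric_proj D x \<in> D"
    and metric_proj_dot: "z \<in> D \<Longrightarrow> 0 \<le> (z - metric_proj D x) \<bullet> (metric_proj D x - x)"
proof -
  obtain p where p: "p \<in> D" "\<And>z. z \<in> D \<Longrightarrow> norm (x - p) \<le> norm (x - z)"
    using nearest_point_exists[OF assms] by metis
  have dot: "0 \<le> (z - p) \<bullet> (p - x)" if "z \<in> D" for z
    using any_closest_point_dot[OF assms(2,1) p(1) that, of x] p(2)
    by (auto simp: dist_norm inner_simps inner_commute algebra_simps)
  have "metric_proj D x = p" by (rule metric_proj_eqI[OF p(1) dot])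
  with p(1) dot show "metric_proj D x \<in> D"
    "z \<in> D \<Longrightarrow> 0 \<le> (z - metric_proj D x) \<bullet> (metric_proj D x - x)" by simp_all
qed

section \<open>The displacement of a strict pseudo-contraction\<close>

lemma norm_le_of_inner_ge:
  fixes b d :: "'a::real_inner"
  assumes "0 < c" "c * (norm b)\<^sup>2 \<le> 2 * (d \<bullet> b)"
  shows "norm b \<le> 2 / c * norm d"
proof (cases "b = 0")
  case False
  have "c * (norm b)\<^sup>2 \<le> 2 * (norm d * norm b)"
    using assms(2) norm_cauchy_schwarz[of d b] by linarith
  then have "(c * norm b) * norm b \<le> (2 * norm d) * norm b" by (simp add: power2_eq_square)
  then have "c * norm b \<le> 2 * norm d" using False by simp
  then show ?thesis using assms(1) by (simp add: field_simps)
qed (use assms in simp)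

text \<open>
  With \<open>d = u - v\<close> and \<open>b\<close> the difference of the displacements, \<open>T u - T v = d - b\<close>; expanding the
  square turns the strict pseudo-contraction inequality into inverse strong monotonicity of
  \<open>I - T\<close>. Together with \<open>norm_le_of_inner_ge\<close> it also yields a Lipschitz constant for \<open>I - T\<close>.
\<close>
lemma displacement_inner_ge:
  assumes "strict_pseudo_contraction_on \<kappa> C T" "u \<in> C" "v \<in> C"
  shows "(1 - \<kappa>) * (norm ((u - T u) - (v - T v)))\<^sup>2 \<le> 2 * ((u - v) \<bullet> ((u - T u) - (v - T v)))"
proof -
  define b where "b = (u - T u) - (v - T v)"
  have Tuv: "T u - T v = (u - v) - b" by (simp add: b_def)
  have "(norm ((u - v) - b))\<^sup>2 \<le> (norm (u - v))\<^sup>2 + \<kappa> * (norm b)\<^sup>2"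
    using assms unfolding strict_pseudo_contraction_on_def Tuv[symmetric] by (simp add: b_def)
  moreover have "(norm ((u - v) - b))\<^sup>2 = (norm (u - v))\<^sup>2 - 2 * ((u - v) \<bullet> b) + (norm b)\<^sup>2"
    unfolding power2_norm_eq_inner by (simp add: inner_simps inner_commute)
  ultimately show ?thesis unfolding b_def[symmetric] by (simp add: algebra_simps)
qed

lemma displacement_monotone:
  assumes "strict_pseudo_contraction_on \<kappa> C T" "\<kappa> < 1" "u \<in> C" "v \<in> C"
  shows "0 \<le> (u - v) \<bullet> ((u - T u) - (v - T v))"
proof -
  have "0 \<le> (1 - \<kappa>) * (norm ((u - T u) - (v - T v)))\<^sup>2" using assms(2) by simp
  with displacement_inner_ge[OF assms(1,3,4)] show ?thesis by linarith
qed

section \<open>A path to the nearest fixed point\<close>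

text \<open>
  The map \<open>T\<close> may be expansive, but its average \<open>S = \<kappa> I + (1 - \<kappa>) T\<close> is nonexpansive, and its
  displacement is \<open>(1 - \<kappa>)\<close> times that of \<open>T\<close>. Hence, with \<open>\<mu> = (1 - \<kappa>) * l\<close>, the equation
  for \<open>z\<close> is \<open>(1 + \<mu>) *\<^sub>R z = \<mu> *\<^sub>R a + S z\<close>, the fixed point equation of a contraction of \<open>C\<close> with
  constant \<open>1 / (1 + \<mu>)\<close>.
\<close>
lemma path_point_exists:
  fixes C :: "'a::{real_inner, complete_space} set"
  assumes C: "closed C" "convex C" and k: "0 \<le> \<kappa>" "\<kappa> < 1"
    and T: "T \<in> C \<rightarrow> C" "strict_pseudo_contraction_on \<kappa> C T"
    and a: "a \<in> C" and l: "0 < l"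
  shows "\<exists>z\<in>C. z - T z = l *\<^sub>R (a - z)"
proof -
  define S where "S z = \<kappa> *\<^sub>R z + (1 - \<kappa>) *\<^sub>R T z" for z
  define \<mu> where "\<mu> = (1 - \<kappa>) * l"
  define f where "f z = (\<mu> / (1 + \<mu>)) *\<^sub>R a + (1 / (1 + \<mu>)) *\<^sub>R S z" for z
  have mu: "0 < \<mu>" using k l by (simp add: \<mu>_def)
  have S_C: "S z \<in> C" if "z \<in> C" for z
    unfolding S_def using C(2) that T(1) k by (intro convexD) auto
  have f_C: "f z \<in> C" if "z \<in> C" for z
    unfolding f_def using C(2) S_C[OF that] a mu
    by (intro convexD) (auto simp: add_divide_distrib[symmetric])
  have S_ne: "norm (S u - S v) \<le> norm (u - v)" if uv: "u \<in> C" "v \<in> C" for u v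
  proof -
    define b where "b = (u - T u) - (v - T v)"
    have "S u - S v = (u - v) - (1 - \<kappa>) *\<^sub>R b" by (simp add: S_def b_def algebra_simps)
    moreover have "(norm ((u - v) - (1 - \<kappa>) *\<^sub>R b))\<^sup>2
        = (norm (u - v))\<^sup>2 - (1 - \<kappa>) * (2 * ((u - v) \<bullet> b) - (1 - \<kappa>) * (norm b)\<^sup>2)"
      unfolding power2_norm_eq_inner by (simp add: inner_simps inner_commute algebra_simps)
    moreover have "0 \<le> (1 - \<kappa>) * (2 * ((u - v) \<bullet> b) - (1 - \<kappa>) * (norm b)\<^sup>2)"
      using displacement_inner_ge[OF T(2) uv] k by (simp add: b_def)
    ultimately have "(norm (S u - S v))\<^sup>2 \<le> (norm (u - v))\<^sup>2" by simp
    then show ?thesis by simp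
  qed
  have "\<exists>!z. z \<in> C \<and> f z = z"
  proof (rule Banach_fix[of C "1 / (1 + \<mu>)"])
    show "complete C" using C(1) by (simp add: complete_eq_closed)
    show "C \<noteq> {}" using a by blast
    show "0 \<le> 1 / (1 + \<mu>)" "1 / (1 + \<mu>) < 1" using mu by simp_all
    show "f ` C \<subseteq> C" using f_C by blast
    fix u v assume "u \<in> C" "v \<in> C"
    have "f u - f v = (1 / (1 + \<mu>)) *\<^sub>R (S u - S v)" by (simp add: f_def algebra_simps)
    then have "dist (f u) (f v) = 1 / (1 + \<mu>) * norm (S u - S v)" using mu by (simp add: dist_norm)
    also have "\<dots> \<le> 1 / (1 + \<mu>) * dist u v"
      using S_ne[OF \<open>u \<in> C\<close> \<open>v \<in> C\<close>] mu by (intro mult_left_mono) (auto simp: dist_norm)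
    finally show "dist (f u) (f v) \<le> 1 / (1 + \<mu>) * dist u v" .
  qed
  then obtain z where z: "z \<in> C" "f z = z" by blast
  have "(1 + \<mu>) *\<^sub>R z = (1 + \<mu>) *\<^sub>R f z" using z(2) by simp
  also have "\<dots> = \<mu> *\<^sub>R a + S z" using mu by (simp add: f_def scaleR_add_right)
  finally have "(1 - \<kappa>) *\<^sub>R (z - T z) = (1 - \<kappa>) *\<^sub>R (l *\<^sub>R (a - z))"
    by (simp add: S_def \<mu>_def algebra_simps)
  then have "z - T z = l *\<^sub>R (a - z)" using k(2) by (subst (asm) scaleR_cancel_left) simp
  with z(1) show ?thesis by blast
qed

text \<open>
  The points \<open>z\<close> and \<open>w\<close> play path points for the parameters \<open>l\<close> and \<open>m\<close>, and the hypothesis is the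
  monotonicity of the displacement along the path. It gives
  \<open>(l + m) * (norm (z - w))\<^sup>2 \<le> (l - m) * ((norm (w - a))\<^sup>2 - (norm (z - a))\<^sup>2)\<close>, so the distance from
  \<open>a\<close> does not shrink as the parameter decreases, and its growth controls the movement along the path.
\<close>
lemma path_norm_sq_diff_le:
  fixes z w a :: "'a::real_inner"
  assumes mono: "0 \<le> (z - w) \<bullet> (l *\<^sub>R (a - z) - m *\<^sub>R (a - w))" and lm: "0 < m" "m \<le> l"
  shows "(norm (z - w))\<^sup>2 \<le> (norm (w - a))\<^sup>2 - (norm (z - a))\<^sup>2"
proof -
  define u v where "u = z - a" and "v = w - a"
  have "0 \<le> (u - v) \<bullet> (m *\<^sub>R v - l *\<^sub>R u)"
    using mono by (simp add: u_def v_def algebra_simps)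
  then have mono': "l * (norm u)\<^sup>2 + m * (norm v)\<^sup>2 \<le> (l + m) * (u \<bullet> v)"
    unfolding power2_norm_eq_inner by (simp add: inner_simps inner_commute algebra_simps)
  have sq: "(norm (u - v))\<^sup>2 = (norm u)\<^sup>2 + (norm v)\<^sup>2 - 2 * (u \<bullet> v)"
    unfolding power2_norm_eq_inner by (simp add: inner_simps inner_commute)
  have eq: "(l + m) * (norm (u - v))\<^sup>2 \<le> (l - m) * ((norm v)\<^sup>2 - (norm u)\<^sup>2)"
    using mono' unfolding sq by (simp add: algebra_simps)
  have nn: "0 \<le> (norm v)\<^sup>2 - (norm u)\<^sup>2"
  proof (cases "l = m")
    case True
    with eq lm have "u = v" by (simp add: mult_le_0_iff)
    then show ?thesis by simp
  next
    case False
    have "0 \<le> (l + m) * (norm (u - v))\<^sup>2" using lm by simp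
    with eq have "0 \<le> (l - m) * ((norm v)\<^sup>2 - (norm u)\<^sup>2)" by linarith
    then show ?thesis using False lm by (simp add: zero_le_mult_iff)
  qed
  have "(l - m) * ((norm v)\<^sup>2 - (norm u)\<^sup>2) \<le> (l + m) * ((norm v)\<^sup>2 - (norm u)\<^sup>2)"
    using nn lm by (intro mult_right_mono) auto
  with eq have "(l + m) * (norm (u - v))\<^sup>2 \<le> (l + m) * ((norm v)\<^sup>2 - (norm u)\<^sup>2)" by linarith
  then have "(norm (u - v))\<^sup>2 \<le> (norm v)\<^sup>2 - (norm u)\<^sup>2" using lm by simp
  then show ?thesis by (simp add: u_def v_def)
qed

text \<open>
  Monotonicity between a path point \<open>z n\<close> and a fixed point \<open>p\<close> reads
  \<open>0 \<le> (p - z n) \<bullet> (z n - a)\<close>. This bounds the path by the distance from \<open>a\<close> to \<open>p\<close>, so the path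
  converges by the preceding estimate. Passing to the limit turns the same inequality into the
  variational inequality that identifies the limit as the nearest fixed point. The limit is fixed because
  \<open>I - T\<close> is Lipschitz and the displacements \<open>l n *\<^sub>R (a - z n)\<close> vanish.
\<close>
lemma path_to_nearest_fixed_point:
  fixes C :: "'a::{real_inner, complete_space} set"
  assumes C: "closed C" "convex C" and k: "0 \<le> \<kappa>" "\<kappa> < 1"
    and T: "T \<in> C \<rightarrow> C" "strict_pseudo_contraction_on \<kappa> C T"
    and F: "fixed_points_on C T \<noteq> {}" and a: "a \<in> C"
  obtains z l q where "\<And>n. z n \<in> C" "\<And>n. 0 < l n" "\<And>n. z n - T (z n) = l n *\<^sub>R (a - z n)"
    "z \<longlonglongrightarrow> q" "q \<in> fixed_points_on C T" "metric_proj (fixed_points_on C T) a = q"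
    "\<And>n p. p \<in> fixed_points_on C T \<Longrightarrow> norm (z n - a) \<le> norm (p - a)"
proof -
  define l where "l n = inverse (real (Suc n))" for n
  have l: "0 < l n" for n by (simp add: l_def)
  have l_decr: "l n \<le> l m" if "m \<le> n" for m n using that by (simp add: l_def field_simps)
  have l_lim: "l \<longlonglongrightarrow> 0" unfolding l_def by (rule LIMSEQ_inverse_real_of_nat)
  have "\<forall>n. \<exists>z. z \<in> C \<and> z - T z = l n *\<^sub>R (a - z)"
    using path_point_exists[OF C k T a l] by blast
  then obtain z where zC: "\<And>n. z n \<in> C" and zT: "\<And>n. z n - T (z n) = l n *\<^sub>R (a - z n)"
    by metis
  have toF: "0 \<le> (p - z n) \<bullet> (z n - a)" if "p \<in> fixed_points_on C T" for n p
  proof -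
    have p: "p \<in> C" "T p = p" using that by (auto simp: fixed_points_on_def)
    have "0 \<le> (z n - p) \<bullet> (l n *\<^sub>R (a - z n))"
      using displacement_monotone[OF T(2) k(2) zC[of n] p(1)] p(2) zT by simp
    then have "0 \<le> (z n - p) \<bullet> (a - z n)" using l[of n] by (simp add: zero_le_mult_iff)
    then show ?thesis by (simp add: inner_simps)
  qed
  have z_le: "norm (z n - a) \<le> norm (p - a)" if "p \<in> fixed_points_on C T" for n p
  proof -
    have "(norm (z n - a))\<^sup>2 \<le> (norm (p - a))\<^sup>2"
      using toF[OF that, of n] norm_sq_three_points[of p a "z n"] by simp
    then show ?thesis by (rule power2_le_imp_le) simp
  qed
  have gap: "(norm (z m - z n))\<^sup>2 \<le> (norm (z n - a))\<^sup>2 - (norm (z m - a))\<^sup>2" if "m \<le> n" for m n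
    using displacement_monotone[OF T(2) k(2) zC[of m] zC[of n]] unfolding zT
    by (rule path_norm_sq_diff_le) (rule l, rule l_decr[OF that])
  obtain p0 where p0: "p0 \<in> fixed_points_on C T" using F by blast
  have inc: "incseq (\<lambda>n. (norm (z n - a))\<^sup>2)"
  proof (rule incseq_SucI)
    fix n
    show "(norm (z n - a))\<^sup>2 \<le> (norm (z (Suc n) - a))\<^sup>2"
      using gap[of n "Suc n"] zero_le_power2[of "norm (z n - z (Suc n))"] by linarith
  qed
  have "(norm (z n - a))\<^sup>2 \<le> (norm (p0 - a))\<^sup>2" for n
    using z_le[OF p0] by (simp add: power_mono)
  then obtain L where L: "(\<lambda>n. (norm (z n - a))\<^sup>2) \<longlonglongrightarrow> L" "\<And>n. (norm (z n - a))\<^sup>2 \<le> L"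
    using incseq_convergent[OF inc] by metis
  have "Cauchy z"
  proof (rule Cauchy_if_norm_sq_diff_le)
    show "(\<lambda>n. L - (norm (z n - a))\<^sup>2) \<longlonglongrightarrow> 0" using tendsto_diff[OF tendsto_const L(1), of L] by simp
    show "(norm (z m - z n))\<^sup>2 \<le> (L - (norm (z m - a))\<^sup>2) + (L - (norm (z n - a))\<^sup>2)" if "m \<le> n" for m n
      using gap[OF that] L(2)[of n] by linarith
  qed
  then obtain q where q: "z \<longlonglongrightarrow> q" using Cauchy_convergent convergent_def by blast
  have qC: "q \<in> C" using closed_sequentially[OF C(1) _ q] zC by blast
  have Az: "(\<lambda>n. z n - T (z n)) \<longlonglongrightarrow> 0"
    unfolding zT using tendsto_scaleR[OF l_lim tendsto_diff[OF tendsto_const q, of a]] by simp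
  have "(\<lambda>n. (q - T q) - (z n - T (z n))) \<longlonglongrightarrow> 0"
  proof (rule Lim_null_comparison)
    show "\<forall>\<^sub>F n in sequentially. norm ((q - T q) - (z n - T (z n))) \<le> 2 / (1 - \<kappa>) * norm (q - z n)"
      using k displacement_inner_ge[OF T(2) qC zC] by (intro always_eventually allI norm_le_of_inner_ge) auto
    show "(\<lambda>n. 2 / (1 - \<kappa>) * norm (q - z n)) \<longlonglongrightarrow> 0"
      by (intro tendsto_mult_right_zero tendsto_norm_zero) (use tendsto_diff[OF tendsto_const q, of q] in simp)
  qed
  then have "(\<lambda>n. q - T q) \<longlonglongrightarrow> 0" using tendsto_add[OF _ Az] by fastforce
  then have "q - T q = 0" by (rule LIMSEQ_unique[OF tendsto_const])
  then have qF: "q \<in> fixed_points_on C T" using qC by (simp add: fixed_points_on_def)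
  have "metric_proj (fixed_points_on C T) a = q"
  proof (rule metric_proj_eqI[OF qF])
    fix p assume "p \<in> fixed_points_on C T"
    moreover have "(\<lambda>n. (p - z n) \<bullet> (z n - a)) \<longlonglongrightarrow> (p - q) \<bullet> (q - a)" by (intro tendsto_intros q)
    ultimately show "0 \<le> (p - q) \<bullet> (q - a)" using toF by (intro LIMSEQ_le_const) blast+
  qed
  then show thesis by (rule that[OF zC l zT q qF _ z_le])
qed

section \<open>Convergence of the hybrid iteration\<close>

text \<open>
  This takes the place of weak compactness and demiclosedness: approximate fixed points that are
  no farther from the anchor than any fixed point must approach the nearest fixed point.
\<close>
lemma tendsto_nearest_fixed_point:
  fixes C :: "'a::{real_inner, complete_space} set"
  assumes C: "closed C" "convex C" and k: "0 \<le> \<kappa>" "\<kappa> < 1"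
    and T: "T \<in> C \<rightarrow> C" "strict_pseudo_contraction_on \<kappa> C T"
    and F: "fixed_points_on C T \<noteq> {}" and a: "a \<in> C"
    and x: "\<And>n. x n \<in> C" "(\<lambda>n. x n - T (x n)) \<longlonglongrightarrow> 0"
    and x_le: "\<And>n p. p \<in> fixed_points_on C T \<Longrightarrow> norm (x n - a) \<le> norm (p - a)"
  shows "x \<longlonglongrightarrow> metric_proj (fixed_points_on C T) a"
proof -
  obtain z l q where zC: "\<And>n. z n \<in> C" and l: "\<And>n. 0 < l n"
    and zT: "\<And>n. z n - T (z n) = l n *\<^sub>R (a - z n)" and q: "z \<longlonglongrightarrow> q"
    and qF: "q \<in> fixed_points_on C T" "metric_proj (fixed_points_on C T) a = q"
    and z_le: "\<And>n. norm (z n - a) \<le> norm (q - a)"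
    using path_to_nearest_fixed_point[OF C k T F a] by metis
  define R where "R = norm (q - a)"
  have est: "(norm (x n - z m))\<^sup>2 \<le> (R\<^sup>2 - (norm (z m - a))\<^sup>2) + 4 * R / l m * norm (x n - T (x n))" for m n
  proof -
    \<comment> \<open>Monotonicity bounds \<open>(x n - z m) \<bullet> (a - z m)\<close>, which is the cross term when
       \<open>(norm (x n - a))\<^sup>2\<close> is expanded around \<open>z m\<close>.\<close>
    have "0 \<le> (x n - z m) \<bullet> ((x n - T (x n)) - l m *\<^sub>R (a - z m))"
      using displacement_monotone[OF T(2) k(2) x(1)[of n] zC[of m]] by (simp add: zT)
    then have "l m * ((x n - z m) \<bullet> (a - z m)) \<le> (x n - z m) \<bullet> (x n - T (x n))"
      by (simp add: inner_simps)
    also have "\<dots> \<le> norm (x n - z m) * norm (x n - T (x n))" by (rule norm_cauchy_schwarz)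
    also have "\<dots> \<le> (2 * R) * norm (x n - T (x n))"
    proof (rule mult_right_mono)
      show "norm (x n - z m) \<le> 2 * R"
        using norm_triangle_ineq4[of "x n - a" "z m - a"] x_le[OF qF(1), of n] z_le[of m]
        by (simp add: R_def)
    qed simp
    finally have "(x n - z m) \<bullet> (a - z m) \<le> 2 * R / l m * norm (x n - T (x n))"
      using l[of m] by (simp add: field_simps)
    moreover have "(norm (x n - z m))\<^sup>2
        = (norm (x n - a))\<^sup>2 - (norm (z m - a))\<^sup>2 + 2 * ((x n - z m) \<bullet> (a - z m))"
      using norm_sq_three_points[of "x n" a "z m"] by (simp add: inner_diff_right)
    moreover have "(norm (x n - a))\<^sup>2 \<le> R\<^sup>2" using x_le[OF qF(1)] by (simp add: R_def power_mono)
    ultimately show ?thesis by simp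
  qed
  have "x \<longlonglongrightarrow> q"
  proof (rule metric_LIMSEQ_I)
    fix e :: real assume e: "0 < e"
    \<comment> \<open>First the path point \<open>z m\<close> is chosen close to \<open>q\<close>, and only then \<open>n\<close> is chosen large, because the
       factor \<open>4 * R / l m\<close> is unbounded in \<open>m\<close> in general.\<close>
    have "(\<lambda>m. R\<^sup>2 - (norm (z m - a))\<^sup>2) \<longlonglongrightarrow> R\<^sup>2 - (norm (q - a))\<^sup>2" by (intro tendsto_intros q)
    then have "\<forall>\<^sub>F m in sequentially. R\<^sup>2 - (norm (z m - a))\<^sup>2 < e\<^sup>2 / 8"
      using e by (intro order_tendstoD) (auto simp: R_def)
    moreover have "\<forall>\<^sub>F m in sequentially. dist (z m) q < e / 2" using q e by (intro tendstoD) auto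
    ultimately have "\<forall>\<^sub>F m in sequentially. R\<^sup>2 - (norm (z m - a))\<^sup>2 < e\<^sup>2 / 8 \<and> dist (z m) q < e / 2"
      by (rule eventually_conj)
    then obtain m where m: "R\<^sup>2 - (norm (z m - a))\<^sup>2 < e\<^sup>2 / 8" "dist (z m) q < e / 2"
      using eventually_happens trivial_limit_sequentially by blast
    have "(\<lambda>n. 4 * R / l m * norm (x n - T (x n))) \<longlonglongrightarrow> 0"
      by (intro tendsto_mult_right_zero tendsto_norm_zero x(2))
    then have "\<forall>\<^sub>F n in sequentially. 4 * R / l m * norm (x n - T (x n)) < e\<^sup>2 / 8"
      using e by (intro order_tendstoD) auto
    then obtain N where N: "\<And>n. n \<ge> N \<Longrightarrow> 4 * R / l m * norm (x n - T (x n)) < e\<^sup>2 / 8"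
      by (auto simp: eventually_sequentially)
    have "dist (x n) q < e" if "n \<ge> N" for n
    proof -
      have "(norm (x n - z m))\<^sup>2 < (e / 2)\<^sup>2"
        using est[of n m] m(1) N[OF that] by (simp add: power_divide)
      then have "norm (x n - z m) < e / 2" by (rule power_less_imp_less_base) (use e in simp)
      then have "dist (x n) (z m) < e / 2" by (simp add: dist_norm)
      then show ?thesis using m(2) dist_triangle[of "x n" q "z m"] by linarith
    qed
    then show "\<exists>N. \<forall>n\<ge>N. dist (x n) q < e" by blast
  qed
  with qF(2) show ?thesis by simp
qed

text \<open>
  With \<open>b = u - t\<close> and \<open>d = u - w\<close> the averaged point minus \<open>w\<close> is \<open>d - \<alpha> *\<^sub>R b\<close>. The coefficient
  \<open>\<alpha> * (\<kappa> - (1 - \<alpha>))\<close> in the cut is such that the terms in \<open>\<alpha>\<^sup>2\<close> cancel, and dividing by \<open>\<alpha>\<close>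
  leaves an inequality independent of \<open>\<alpha>\<close>.
\<close>
lemma displacement_le_of_hybrid_cut:
  fixes u w t :: "'a::real_inner"
  assumes k: "\<kappa> < 1" and al: "0 < \<alpha>"
    and cut: "(norm ((1 - \<alpha>) *\<^sub>R u + \<alpha> *\<^sub>R t - w))\<^sup>2
      \<le> (norm (u - w))\<^sup>2 + \<alpha> * (\<kappa> - (1 - \<alpha>)) * (norm (u - t))\<^sup>2"
  shows "norm (u - t) \<le> 2 / (1 - \<kappa>) * norm (u - w)"
proof (rule norm_le_of_inner_ge)
  define b d where "b = u - t" and "d = u - w"
  have "(1 - \<alpha>) *\<^sub>R u + \<alpha> *\<^sub>R t - w = d - \<alpha> *\<^sub>R b" by (simp add: b_def d_def algebra_simps)
  then have "(norm ((1 - \<alpha>) *\<^sub>R u + \<alpha> *\<^sub>R t - w))\<^sup>2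
      = (norm d)\<^sup>2 - 2 * \<alpha> * (d \<bullet> b) + \<alpha>\<^sup>2 * (norm b)\<^sup>2"
    unfolding power2_norm_eq_inner by (simp add: inner_simps inner_commute power2_eq_square)
  with cut have "\<alpha> * ((1 - \<kappa>) * (norm b)\<^sup>2) \<le> \<alpha> * (2 * (d \<bullet> b))"
    by (simp add: b_def[symmetric] d_def[symmetric] power2_eq_square algebra_simps)
  then show "(1 - \<kappa>) * (norm (u - t))\<^sup>2 \<le> 2 * ((u - w) \<bullet> (u - t))"
    using al by (simp add: b_def d_def)
qed (use k in simp)

theorem theorem5p3:
  fixes C :: "'a::{real_inner, complete_space} set"
    and T :: "'a \<Rightarrow> 'a"
    and \<kappa> a :: real
    and \<alpha> :: "nat \<Rightarrow> real"
    and x y :: "nat \<Rightarrow> 'a"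
    and Cn Cstar Q :: "nat \<Rightarrow> 'a set"
  assumes "C \<noteq> {}" and "closed C" and "convex C"
    and "0 \<le> \<kappa>" and "\<kappa> < 1"
    and "T \<in> C \<rightarrow> C"
    and "strict_pseudo_contraction_on \<kappa> C T"
    and "fixed_points_on C T \<noteq> {}"
    and "0 < a" and "\<And>n. a \<le> \<alpha> n" and "\<And>n. \<alpha> n \<le> 1"
    and "x 0 \<in> C"
    and "\<And>n. y n = (1 - \<alpha> n) *\<^sub>R x n + \<alpha> n *\<^sub>R T (x n)"
    and "\<And>n. Cn n = {z \<in> C. (norm (y n - z))\<^sup>2 \<le>
            (norm (x n - z))\<^sup>2 + \<alpha> n * (\<kappa> - (1 - \<alpha> n)) * (norm (x n - T (x n)))\<^sup>2}"
    and "\<And>n. Q n = {z \<in> C. (z - x n) \<bullet> (x n - x 0) \<ge> 0}"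
    and "\<And>n. closed (Cstar n)" and "\<And>n. convex (Cstar n)"
    and "\<And>n. fixed_points_on C T \<subseteq> Cstar n" and "\<And>n. Cstar n \<subseteq> Cn n"
    and "\<And>n. x (Suc n) = metric_proj (Cstar n \<inter> Q n) (x 0)"
  shows "x \<longlonglongrightarrow> metric_proj (fixed_points_on C T) (x 0)"
proof -
  note C = assms(2,3) and k = assms(4,5) and T = assms(6,7)
  note y = assms(13) and Cn = assms(14) and Q = assms(15) and Cstar_sub = assms(19)
  let ?F = "fixed_points_on C T"
  \<comment> \<open>The two claims depend on each other: the projection obeys its variational inequality only if
     the set projected onto is nonempty, which is known once it contains the fixed points; and that
     inequality, at a fixed point, is membership in the next half-space.\<close>
  have step: "x (Suc n) \<in> Cstar n \<inter> Q n \<and> ?F \<subseteq> Q (Suc n)" if "?F \<subseteq> Q n" for n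
  proof -
    have Qn: "Q n = C \<inter> {z. (x n - x 0) \<bullet> x n \<le> (x n - x 0) \<bullet> z}"
      unfolding Q by (auto simp: inner_simps inner_commute)
    have D: "closed (Cstar n \<inter> Q n)" "convex (Cstar n \<inter> Q n)"
      unfolding Qn using C assms(16,17)
      by (auto intro!: closed_Int convex_Int closed_halfspace_ge convex_halfspace_ge)
    have F_D: "?F \<subseteq> Cstar n \<inter> Q n" using assms(18) that by blast
    then have ne: "Cstar n \<inter> Q n \<noteq> {}" using assms(8) by blast
    have "x (Suc n) \<in> Cstar n \<inter> Q n" using metric_proj_mem[OF D ne] assms(20) by simp
    moreover have "?F \<subseteq> Q (Suc n)"
    proof
      fix p assume p: "p \<in> ?F"
      then have "0 \<le> (p - x (Suc n)) \<bullet> (x (Suc n) - x 0)"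
        using metric_proj_dot[OF D ne, of p "x 0"] F_D assms(20) by auto
      with p show "p \<in> Q (Suc n)" unfolding Q by (simp add: fixed_points_on_def)
    qed
    ultimately show ?thesis by blast
  qed
  have FQ: "?F \<subseteq> Q n" for n
  proof (induction n)
    case 0 show ?case unfolding Q by (auto simp: fixed_points_on_def)
  qed (use step in blast)
  have xS: "x (Suc n) \<in> Cn n" "x (Suc n) \<in> Q n" for n using step[OF FQ, of n] Cstar_sub by auto
  have xC: "x n \<in> C" for n using assms(12) xS(2) unfolding Q by (cases n) auto
  have gap: "(norm (x n - x 0))\<^sup>2 + (norm (w - x n))\<^sup>2 \<le> (norm (w - x 0))\<^sup>2" if "w \<in> Q n" for n w
  proof -
    have "0 \<le> (w - x n) \<bullet> (x n - x 0)" using that unfolding Q by blast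
    then show ?thesis using norm_sq_three_points[of w "x 0" "x n"] by simp
  qed
  have x_le: "norm (x n - x 0) \<le> norm (p - x 0)" if "p \<in> ?F" for n p
    using gap[of p n] FQ that by (smt (verit) norm_ge_zero power2_le_imp_le subsetD zero_le_power2)
  have inc: "incseq (\<lambda>n. (norm (x n - x 0))\<^sup>2)"
    by (rule incseq_SucI) (use gap[OF xS(2)] in \<open>smt (verit) zero_le_power2\<close>)
  obtain p0 where p0: "p0 \<in> ?F" using assms(8) by blast
  have "(norm (x n - x 0))\<^sup>2 \<le> (norm (p0 - x 0))\<^sup>2" for n
    using x_le[OF p0] by (simp add: power_mono)
  then obtain L where L: "(\<lambda>n. (norm (x n - x 0))\<^sup>2) \<longlonglongrightarrow> L" using incseq_convergent[OF inc] by metis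
  have diff_lim: "(\<lambda>n. (norm (x (Suc n) - x 0))\<^sup>2 - (norm (x n - x 0))\<^sup>2) \<longlonglongrightarrow> 0"
    using tendsto_diff[OF LIMSEQ_Suc[OF L] L] by simp
  have "(\<lambda>n. (norm (x n - x (Suc n)))\<^sup>2) \<longlonglongrightarrow> 0"
    by (rule tendsto_sandwich[OF _ _ tendsto_const diff_lim])
      (use gap[OF xS(2)] in \<open>auto simp: norm_minus_commute intro!: always_eventually, smt (verit)\<close>)
  then have d: "(\<lambda>n. norm (x n - x (Suc n))) \<longlonglongrightarrow> 0"
    using tendsto_real_sqrt by fastforce
  have "(\<lambda>n. x n - T (x n)) \<longlonglongrightarrow> 0"
  proof (rule Lim_null_comparison)
    have "norm (x n - T (x n)) \<le> 2 / (1 - \<kappa>) * norm (x n - x (Suc n))" for n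
    proof (rule displacement_le_of_hybrid_cut[OF k(2)])
      show "0 < \<alpha> n" using assms(9) assms(10)[of n] by linarith
      show "(norm ((1 - \<alpha> n) *\<^sub>R x n + \<alpha> n *\<^sub>R T (x n) - x (Suc n)))\<^sup>2
        \<le> (norm (x n - x (Suc n)))\<^sup>2 + \<alpha> n * (\<kappa> - (1 - \<alpha> n)) * (norm (x n - T (x n)))\<^sup>2"
        using xS(1)[of n] unfolding Cn y by blast
    qed
    then show "\<forall>\<^sub>F n in sequentially. norm (x n - T (x n)) \<le> 2 / (1 - \<kappa>) * norm (x n - x (Suc n))"
      by simp
    show "(\<lambda>n. 2 / (1 - \<kappa>) * norm (x n - x (Suc n))) \<longlonglongrightarrow> 0" by (rule tendsto_mult_right_zero[OF d])
  qed
  then show ?thesis by (rule tendsto_nearest_fixed_point[OF C k T assms(8,12) xC _ x_le])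
qed

end
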